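(* Let $X$ be a topological module over a topological ring $R$, and let $B_b(X\times X)$ be the set of all $b$-bounded bigroup homomorphisms $X\times X\to X$, with pointwise addition and pointwise multiplication by elements of $R$. Then addition and module multiplication in $B_b(X\times X)$ are continuous with respect to the topology of uniform convergence on bounded sets. That is, if $(\sigma_\alpha)$ and $(\gamma_\alpha)$ are nets in $B_b(X\times X)$ and $(r_\alpha)$ is a net in $R$, all indexed by the same directed set, such that $\sigma_\alpha\to\sigma\in B_b(X\times X)$ and $\gamma_\alpha\to\gamma\in B_b(X\times X)$ uniformly on bounded sets and $r_\alpha\to r$ in $R$, then $\sigma_\alpha+\gamma_\alpha\to\sigma+\gamma$ and $r_\alpha\sigma_\alpha\to r\sigma$ uniformly on bounded sets.
   Context: A topological module $X$ over a topological ring $R$ is an $R$-module with a topology making $X$ a topological additive group and making the multiplication $R\times X\to X$ (jointly) continuous. A zero neighborhood is a neighborhood of $0$. A set $B\subseteq X$ is bounded if for each zero neighborhood $W\subseteq X$ there is a zero neighborhood $V\subseteq R$ such that $VB\subseteq W$, where $VB=\{vb: v\in V, b\in B\}$. A bigroup homomorphism $\sigma:X\times X\to X$ is a map that is a homomorphism of additive groups in each variable separately. For $A,B\subseteq X$, $\sigma(A,B)=\{\sigma(a,b):a\in A,b\in B\}$. $\sigma$ is $b$-bounded if for all bounded sets $B_1,B_2\subseteq X$, $\sigma(B_1,B_2)$ is bounded in $X$. A net $(\sigma_\alpha)$ of bigroup homomorphisms converges to zero uniformly on bounded sets if for all bounded sets $B_1,B_2\subseteq X$ and each zero neighborhood $W\subseteq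 X$ there is an $\alpha_0$ with $\sigma_\alpha(B_1,B_2)\subseteq W$ for all $\alpha\ge\alpha_0$. It converges to $\sigma$ in this sense if $(\sigma_\alpha-\sigma)$ converges to zero in this sense. *)

theory Defs
  imports "HOL-Analysis.Analysis"
begin

text \<open>Rings need not be commutative or unital, and no separation axiom is imposed.\<close>

class topological_ring = ring + topological_ab_group_add + topological_semigroup_mult

locale topological_module =
  fixes smul :: "'r::topological_ring \<Rightarrow> 'x::topological_ab_group_add \<Rightarrow> 'x"
  assumes smul_add_right: "smul a (x + y) = smul a x + smul a y"
    and smul_add_left: "smul (a + b) x = smul a x + smul b x"
    and smul_smul: "smul a (smul b x) = smul (a * b) x"
    and continuous_smul: "continuous_on UNIV (\<lambda>(a, x). smul a x)"

definition zero_nbhd :: "'a::{topological_space, zero} set \<Rightarrow> bool"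
  where "zero_nbhd W \<longleftrightarrow> (\<exists>U. open U \<and> 0 \<in> U \<and> U \<subseteq> W)"

definition module_bounded ::
    "('r::topological_ring \<Rightarrow> 'x::topological_ab_group_add \<Rightarrow> 'x) \<Rightarrow> 'x set \<Rightarrow> bool"
  where "module_bounded smul B \<longleftrightarrow>
    (\<forall>W. zero_nbhd W \<longrightarrow> (\<exists>V. zero_nbhd V \<and> (\<lambda>(v, b). smul v b) ` (V \<times> B) \<subseteq> W))"

definition bigroup_hom :: "('x::ab_group_add \<times> 'x \<Rightarrow> 'x) \<Rightarrow> bool"
  where "bigroup_hom \<sigma> \<longleftrightarrow>
    (\<forall>y. Modules.additive (\<lambda>x. \<sigma> (x, y))) \<and> (\<forall>x. Modules.additive (\<lambda>y. \<sigma> (x, y)))"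

definition b_bounded ::
    "('r::topological_ring \<Rightarrow> 'x::topological_ab_group_add \<Rightarrow> 'x) \<Rightarrow> ('x \<times> 'x \<Rightarrow> 'x) \<Rightarrow> bool"
  where "b_bounded smul \<sigma> \<longleftrightarrow>
    (\<forall>B1 B2. module_bounded smul B1 \<longrightarrow> module_bounded smul B2 \<longrightarrow>
      module_bounded smul (\<sigma> ` (B1 \<times> B2)))"

definition Bb ::
    "('r::topological_ring \<Rightarrow> 'x::topological_ab_group_add \<Rightarrow> 'x) \<Rightarrow> ('x \<times> 'x \<Rightarrow> 'x) set"
  where "Bb smul = {\<sigma>. bigroup_hom \<sigma> \<and> b_bounded smul \<sigma>}"

definition directed_set :: "'i set \<Rightarrow> ('i \<Rightarrow> 'i \<Rightarrow> bool) \<Rightarrow> bool"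
  where "directed_set D le \<longleftrightarrow> D \<noteq> {} \<and>
    (\<forall>a\<in>D. le a a) \<and>
    (\<forall>a\<in>D. \<forall>b\<in>D. \<forall>c\<in>D. le a b \<longrightarrow> le b c \<longrightarrow> le a c) \<and>
    (\<forall>a\<in>D. \<forall>b\<in>D. \<exists>c\<in>D. le a c \<and> le b c)"

text \<open>The filter of tails: convergence of a net is convergence along this filter.\<close>

definition net_filter :: "'i set \<Rightarrow> ('i \<Rightarrow> 'i \<Rightarrow> bool) \<Rightarrow> 'i filter"
  where "net_filter D le = (INF a\<in>D. principal {b\<in>D. le a b})"

lemma eventually_net_filter:
  assumes "directed_set D le"
  shows "eventually P (net_filter D le) \<longleftrightarrow> (\<exists>a\<in>D. \<forall>b\<in>D. le a b \<longrightarrow> P b)"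
proof -
  have "eventually P (net_filter D le) \<longleftrightarrow>
      (\<exists>a\<in>D. eventually P (principal {b\<in>D. le a b}))"
    unfolding net_filter_def
  proof (rule eventually_INF_base)
    show "D \<noteq> {}" using assms by (simp add: directed_set_def)
    fix a b assume ab: "a \<in> D" "b \<in> D"
    then obtain c where c: "c \<in> D" "le a c" "le b c"
      using assms unfolding directed_set_def by blast
    have "\<forall>d\<in>D. le c d \<longrightarrow> le a d \<and> le b d"
      using assms ab c unfolding directed_set_def by blast
    then show "\<exists>x\<in>D. principal {b\<in>D. le x b} \<le>
        inf (principal {d\<in>D. le a d}) (principal {d\<in>D. le b d})"
      using c(1) by (intro bexI[of _ c]) auto
  qed
  then show ?thesis by (auto simp: eventually_principal)
qed

definition converges_zero_ub ::
    "('r::topological_ring \<Rightarrow> 'x::topological_ab_group_add \<Rightarrow> 'x) \<Rightarrow>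
      'i set \<Rightarrow> ('i \<Rightarrow> 'i \<Rightarrow> bool) \<Rightarrow> ('i \<Rightarrow> 'x \<times> 'x \<Rightarrow> 'x) \<Rightarrow> bool"
  where "converges_zero_ub smul D le s \<longleftrightarrow>
    (\<forall>B1 B2 W. module_bounded smul B1 \<longrightarrow> module_bounded smul B2 \<longrightarrow> zero_nbhd W \<longrightarrow>
      (\<exists>\<alpha>0\<in>D. \<forall>\<alpha>\<in>D. le \<alpha>0 \<alpha> \<longrightarrow> s \<alpha> ` (B1 \<times> B2) \<subseteq> W))"

definition converges_ub ::
    "('r::topological_ring \<Rightarrow> 'x::topological_ab_group_add \<Rightarrow> 'x) \<Rightarrow>
      'i set \<Rightarrow> ('i \<Rightarrow> 'i \<Rightarrow> bool) \<Rightarrow> ('i \<Rightarrow> 'x \<times> 'x \<Rightarrow> 'x) \<Rightarrow> ('x \<times> 'x \<Rightarrow> 'x) \<Rightarrow> bool"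
  where "converges_ub smul D le s \<sigma> \<longleftrightarrow>
    converges_zero_ub smul D le (\<lambda>\<alpha> p. s \<alpha> p - \<sigma> p)"

definition ub_nbhd ::
    "('r::topological_ring \<Rightarrow> 'x::topological_ab_group_add \<Rightarrow> 'x) \<Rightarrow>
      ('x \<times> 'x \<Rightarrow> 'x) \<Rightarrow> 'x set \<Rightarrow> 'x set \<Rightarrow> 'x set \<Rightarrow> ('x \<times> 'x \<Rightarrow> 'x) set"
  where "ub_nbhd smul \<sigma> B1 B2 W =
    {\<tau> \<in> Bb smul. (\<lambda>p. \<tau> p - \<sigma> p) ` (B1 \<times> B2) \<subseteq> W}"

text \<open>The topology of uniform convergence on bounded sets. The sets \<open>ub_nbhd\<close> are a base of
  neighborhoods at \<open>\<sigma>\<close>; lemma \<open>limitin_ub_topology\<close> below shows that net convergence in this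
  topology is exactly \<open>converges_ub\<close>.\<close>

definition ub_topology ::
    "('r::topological_ring \<Rightarrow> 'x::topological_ab_group_add \<Rightarrow> 'x) \<Rightarrow> ('x \<times> 'x \<Rightarrow> 'x) topology"
  where "ub_topology smul = topology (\<lambda>S. S \<subseteq> Bb smul \<and>
    (\<forall>\<sigma>\<in>S. \<exists>B1 B2 W. module_bounded smul B1 \<and> module_bounded smul B2 \<and> zero_nbhd W \<and>
      ub_nbhd smul \<sigma> B1 B2 W \<subseteq> S))"

lemma zero_nbhd_Int: "zero_nbhd V \<Longrightarrow> zero_nbhd W \<Longrightarrow> zero_nbhd (V \<inter> W)"
  unfolding zero_nbhd_def by (meson IntI Int_mono open_Int)

lemma zero_nbhd_UNIV: "zero_nbhd UNIV"
  unfolding zero_nbhd_def by blast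

lemma zero_nbhd_add:
  fixes W :: "'x::topological_ab_group_add set"
  assumes "zero_nbhd W"
  obtains V where "zero_nbhd V" "\<And>x y. x \<in> V \<Longrightarrow> y \<in> V \<Longrightarrow> x + y \<in> W"
proof -
  obtain U where U: "open U" "0 \<in> U" "U \<subseteq> W"
    using assms unfolding zero_nbhd_def by blast
  have "((\<lambda>p. fst p + snd p) \<longlongrightarrow> (0::'x) + 0) (nhds 0 \<times>\<^sub>F nhds 0)"
    by (intro tendsto_add filterlim_fst filterlim_snd)
  then have "eventually (\<lambda>p. fst p + snd p \<in> U) (nhds (0::'x) \<times>\<^sub>F nhds 0)"
    using U by (auto dest: topological_tendstoD)
  then obtain P Q where PQ: "eventually P (nhds (0::'x))" "eventually Q (nhds (0::'x))"
    "\<And>x y. P x \<Longrightarrow> Q y \<Longrightarrow> x + y \<in> U"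
    by (auto simp: eventually_prod_filter)
  obtain A B where "open A" "0 \<in> A" "\<forall>x\<in>A. P x" "open B" "0 \<in> B" "\<forall>x\<in>B. Q x"
    using PQ(1,2) unfolding eventually_nhds by blast
  with PQ(3) U have "zero_nbhd (A \<inter> B)" "\<And>x y. x \<in> A \<inter> B \<Longrightarrow> y \<in> A \<inter> B \<Longrightarrow> x + y \<in> W"
    by (auto simp: zero_nbhd_def)
  then show thesis using that by blast
qed

lemma module_bounded_empty: "module_bounded smul {}"
  unfolding module_bounded_def using zero_nbhd_UNIV by auto

lemma module_bounded_Un:
  assumes "module_bounded smul A" "module_bounded smul B"
  shows "module_bounded smul (A \<union> B)"
  unfolding module_bounded_def
proof (intro allI impI)
  fix W :: "'b set" assume "zero_nbhd W"
  then obtain V1 V2 where "zero_nbhd V1" "(\<lambda>(v, b). smul v b) ` (V1 \<times> A) \<subseteq> W"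
    "zero_nbhd V2" "(\<lambda>(v, b). smul v b) ` (V2 \<times> B) \<subseteq> W"
    using assms unfolding module_bounded_def by metis
  then show "\<exists>V. zero_nbhd V \<and> (\<lambda>(v, b). smul v b) ` (V \<times> (A \<union> B)) \<subseteq> W"
    by (intro exI[of _ "V1 \<inter> V2"]) (auto intro: zero_nbhd_Int simp: image_subset_iff)
qed

lemma openin_ub_topology:
  "openin (ub_topology smul) S \<longleftrightarrow> S \<subseteq> Bb smul \<and>
    (\<forall>\<sigma>\<in>S. \<exists>B1 B2 W. module_bounded smul B1 \<and> module_bounded smul B2 \<and> zero_nbhd W \<and>
      ub_nbhd smul \<sigma> B1 B2 W \<subseteq> S)"
proof -
  let ?N = "\<lambda>S \<sigma>. \<exists>B1 B2 W. module_bounded smul B1 \<and> module_bounded smul B2 \<and>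
    zero_nbhd W \<and> ub_nbhd smul \<sigma> B1 B2 W \<subseteq> S"
  have N_Int: "?N (S \<inter> T) \<sigma>" if NS: "?N S \<sigma>" and NT: "?N T \<sigma>" for S T \<sigma>
  proof -
    obtain B1 B2 W where *: "module_bounded smul B1" "module_bounded smul B2"
      "zero_nbhd W" "ub_nbhd smul \<sigma> B1 B2 W \<subseteq> S"
      using NS by blast
    obtain C1 C2 V where **: "module_bounded smul C1"
      "module_bounded smul C2" "zero_nbhd V" "ub_nbhd smul \<sigma> C1 C2 V \<subseteq> T"
      using NT by blast
    have "ub_nbhd smul \<sigma> (B1 \<union> C1) (B2 \<union> C2) (W \<inter> V) \<subseteq>
        ub_nbhd smul \<sigma> B1 B2 W \<inter> ub_nbhd smul \<sigma> C1 C2 V"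
      unfolding ub_nbhd_def by (auto simp: image_subset_iff)
    with * ** show ?thesis
      by (intro exI[of _ "B1 \<union> C1"] exI[of _ "B2 \<union> C2"] exI[of _ "W \<inter> V"])
        (auto intro: module_bounded_Un zero_nbhd_Int)
  qed
  have "istopology (\<lambda>S. S \<subseteq> Bb smul \<and> (\<forall>\<sigma>\<in>S. ?N S \<sigma>))"
    unfolding istopology_def
  proof (intro conjI allI impI)
    fix S T assume "S \<subseteq> Bb smul \<and> (\<forall>\<sigma>\<in>S. ?N S \<sigma>)" "T \<subseteq> Bb smul \<and> (\<forall>\<sigma>\<in>T. ?N T \<sigma>)"
    then show "S \<inter> T \<subseteq> Bb smul" "\<forall>\<sigma>\<in>S \<inter> T. ?N (S \<inter> T) \<sigma>"
      using N_Int by blast+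
  next
    fix \<K> assume *: "\<forall>K\<in>\<K>. K \<subseteq> Bb smul \<and> (\<forall>\<sigma>\<in>K. ?N K \<sigma>)"
    then show "\<Union>\<K> \<subseteq> Bb smul" by blast
    show "\<forall>\<sigma>\<in>\<Union>\<K>. ?N (\<Union>\<K>) \<sigma>"
    proof
      fix \<sigma> assume "\<sigma> \<in> \<Union>\<K>"
      then obtain K where "K \<in> \<K>" "\<sigma> \<in> K" by blast
      moreover from this have "?N K \<sigma>" using * by blast
      ultimately show "?N (\<Union>\<K>) \<sigma>" by (meson Union_upper order_trans)
    qed
  qed
  then show ?thesis
    unfolding ub_topology_def by (simp add: topology_inverse')
qed

lemma topspace_ub_topology: "topspace (ub_topology smul) = Bb smul"
proof -
  have "openin (ub_topology smul) (Bb smul)"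
    unfolding openin_ub_topology
    using module_bounded_empty zero_nbhd_UNIV by (auto simp: ub_nbhd_def)
  then show ?thesis
    unfolding topspace_def by (auto simp: openin_ub_topology)
qed

lemma ub_nbhd_contains_openin:
  assumes \<sigma>: "\<sigma> \<in> Bb smul" and B: "module_bounded smul B1" "module_bounded smul B2"
    and W: "zero_nbhd W"
  obtains S where "openin (ub_topology smul) S" "\<sigma> \<in> S" "S \<subseteq> ub_nbhd smul \<sigma> B1 B2 W"
proof
  let ?S = "{\<tau> \<in> Bb smul. \<exists>V. zero_nbhd V \<and> ub_nbhd smul \<tau> B1 B2 V \<subseteq> ub_nbhd smul \<sigma> B1 B2 W}"
  show "\<sigma> \<in> ?S" using \<sigma> W by blast
  show "?S \<subseteq> ub_nbhd smul \<sigma> B1 B2 W"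
  proof
    fix \<tau> assume "\<tau> \<in> ?S"
    then obtain V where "\<tau> \<in> Bb smul" "zero_nbhd V"
      "ub_nbhd smul \<tau> B1 B2 V \<subseteq> ub_nbhd smul \<sigma> B1 B2 W" by blast
    moreover have "\<tau> \<in> ub_nbhd smul \<tau> B1 B2 V"
      using \<open>\<tau> \<in> Bb smul\<close> \<open>zero_nbhd V\<close> by (auto simp: ub_nbhd_def zero_nbhd_def)
    ultimately show "\<tau> \<in> ub_nbhd smul \<sigma> B1 B2 W" by blast
  qed
  show "openin (ub_topology smul) ?S"
    unfolding openin_ub_topology
  proof (intro conjI ballI)
    show "?S \<subseteq> Bb smul" by blast
    fix \<tau> assume "\<tau> \<in> ?S"
    then obtain V where V: "zero_nbhd V"
      "ub_nbhd smul \<tau> B1 B2 V \<subseteq> ub_nbhd smul \<sigma> B1 B2 W" by blast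
    obtain V' where V': "zero_nbhd V'" "\<And>x y. x \<in> V' \<Longrightarrow> y \<in> V' \<Longrightarrow> x + y \<in> V"
      using zero_nbhd_add[OF V(1)] by blast
    have "ub_nbhd smul \<tau> B1 B2 V' \<subseteq> ?S"
    proof
      fix \<rho> assume \<rho>: "\<rho> \<in> ub_nbhd smul \<tau> B1 B2 V'"
      have "ub_nbhd smul \<rho> B1 B2 V' \<subseteq> ub_nbhd smul \<tau> B1 B2 V"
      proof
        fix \<kappa> assume \<kappa>: "\<kappa> \<in> ub_nbhd smul \<rho> B1 B2 V'"
        have "\<kappa> p - \<tau> p \<in> V" if "p \<in> B1 \<times> B2" for p
        proof -
          have "\<kappa> p - \<rho> p \<in> V'" "\<rho> p - \<tau> p \<in> V'"
            using \<kappa> \<rho> that by (auto simp: ub_nbhd_def)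
          from V'(2)[OF this] show ?thesis by simp
        qed
        with \<kappa> show "\<kappa> \<in> ub_nbhd smul \<tau> B1 B2 V"
          by (auto simp: ub_nbhd_def)
      qed
      then have "ub_nbhd smul \<rho> B1 B2 V' \<subseteq> ub_nbhd smul \<sigma> B1 B2 W"
        using V(2) by blast
      moreover have "\<rho> \<in> Bb smul" using \<rho> by (simp add: ub_nbhd_def)
      ultimately show "\<rho> \<in> ?S" using V'(1) by blast
    qed
    with B V' show "\<exists>B1 B2 W. module_bounded smul B1 \<and> module_bounded smul B2 \<and>
        zero_nbhd W \<and> ub_nbhd smul \<tau> B1 B2 W \<subseteq> ?S" by blast
  qed
qed

lemma limitin_ub_topology:
  assumes D: "directed_set D le" and s: "\<And>\<alpha>. \<alpha> \<in> D \<Longrightarrow> s \<alpha> \<in> Bb smul"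
    and \<sigma>: "\<sigma> \<in> Bb smul"
  shows "limitin (ub_topology smul) s \<sigma> (net_filter D le) \<longleftrightarrow> converges_ub smul D le s \<sigma>"
proof
  assume L: "limitin (ub_topology smul) s \<sigma> (net_filter D le)"
  show "converges_ub smul D le s \<sigma>"
    unfolding converges_ub_def converges_zero_ub_def
  proof (intro allI impI)
    fix B1 B2 W :: "'b set"
    assume "module_bounded smul B1" "module_bounded smul B2" "zero_nbhd W"
    then obtain S where S: "openin (ub_topology smul) S" "\<sigma> \<in> S"
      "S \<subseteq> ub_nbhd smul \<sigma> B1 B2 W"
      using ub_nbhd_contains_openin[OF \<sigma>] by metis
    then have "eventually (\<lambda>\<alpha>. s \<alpha> \<in> S) (net_filter D le)"
      using L by (simp add: limitin_def)
    with S(3) show "\<exists>\<alpha>0\<in>D. \<forall>\<alpha>\<in>D. le \<alpha>0 \<alpha> \<longrightarrow> (\<lambda>p. s \<alpha> p - \<sigma> p) ` (B1 \<times> B2) \<subseteq> W"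
      unfolding eventually_net_filter[OF D] ub_nbhd_def by blast
  qed
next
  assume C: "converges_ub smul D le s \<sigma>"
  show "limitin (ub_topology smul) s \<sigma> (net_filter D le)"
    unfolding limitin_def topspace_ub_topology
  proof (intro conjI allI impI \<sigma>)
    fix S assume "openin (ub_topology smul) S \<and> \<sigma> \<in> S"
    then obtain B1 B2 W where *: "module_bounded smul B1" "module_bounded smul B2"
      "zero_nbhd W" "ub_nbhd smul \<sigma> B1 B2 W \<subseteq> S"
      unfolding openin_ub_topology by metis
    then obtain a where "a \<in> D"
      "\<forall>\<alpha>\<in>D. le a \<alpha> \<longrightarrow> (\<lambda>p. s \<alpha> p - \<sigma> p) ` (B1 \<times> B2) \<subseteq> W"
      using C unfolding converges_ub_def converges_zero_ub_def by metis
    with * s show "eventually (\<lambda>\<alpha>. s \<alpha> \<in> S) (net_filter D le)"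
      unfolding eventually_net_filter[OF D] ub_nbhd_def by blast
  qed
qed

end

theory Submission
  imports Defs
begin

text \<open>
  The topology of uniform convergence on bounded sets has the sets \<open>ub_nbhd \<sigma> B1 B2 W\<close> as
  neighborhood bases, so convergence along an arbitrary filter \<open>F\<close> can be tested on them
  (\<open>limitin_ub_topology_iff\<close>). It is therefore enough to prove two limit laws for arbitrary
  filters: nets are the filters of tails, and continuity at a point is the limit law for the
  filter of punctured neighborhoods of that point, applied to the two coordinate projections.

  The law for sums (\<open>limitin_ub_add\<close>) splits \<open>W\<close> into two halves. The law for multiples
  (\<open>limitin_ub_smul\<close>) rests on the decomposition
  \<open>r\<^sub>\<alpha> \<sigma>\<^sub>\<alpha> - r \<sigma> = r\<^sub>\<alpha> (\<sigma>\<^sub>\<alpha> - \<sigma>) + (r\<^sub>\<alpha> - r) \<sigma>\<close>.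
  The first term is small on \<open>B1 \<times> B2\<close> because multiplication is jointly continuous at \<open>(r, 0)\<close>
  (\<open>smul_small_near\<close>). The second is small because \<open>\<sigma>\<close> is \<open>b\<close>-bounded: the set \<open>\<sigma>(B1, B2)\<close>
  is bounded, hence is sent into any given zero neighborhood by all scalars close to zero.

  Both laws also need the sums and multiples to be \<open>b\<close>-bounded again, which holds because
  bounded sets are stable under sums and under multiplication by a fixed scalar.
\<close>

section \<open>Scalar multiplication near zero\<close>

lemma zero_nbhd_iff_eventually: "zero_nbhd W \<longleftrightarrow> (\<forall>\<^sub>F x in nhds 0. x \<in> W)"
  by (auto simp: zero_nbhd_def eventually_nhds)

lemma additive_plus:
  assumes "Modules.additive f" "Modules.additive g"
  shows "Modules.additive (\<lambda>x. f x + g x)"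
  using assms by (simp add: Modules.additive_def algebra_simps)

context topological_module
begin

lemma additive_smul_right: "Modules.additive (smul a)"
  by (simp add: Modules.additive_def smul_add_right)

lemma smul_zero_right: "smul a 0 = 0"
  by (rule additive.zero[OF additive_smul_right])

lemma smul_diff_right: "smul a (x - y) = smul a x - smul a y"
  by (rule additive.diff[OF additive_smul_right])

lemma smul_diff_left: "smul (a - b) x = smul a x - smul b x"
proof -
  have "Modules.additive (\<lambda>a. smul a x)"
    by (simp add: Modules.additive_def smul_add_left)
  then show ?thesis
    by (rule additive.diff)
qed

text \<open>Joint continuity at \<open>(r, 0)\<close> gives one zero neighborhood \<open>V\<close> that serves all scalars
  close to \<open>r\<close>; continuity in each variable separately would not suffice for the limit of a
  product in which both factors vary.\<close>

lemma smul_small_near: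
  assumes "zero_nbhd W"
  obtains V where "zero_nbhd V" "\<forall>\<^sub>F a in nhds r. \<forall>x\<in>V. smul a x \<in> W"
proof -
  have "((\<lambda>(a, x). smul a x) \<longlongrightarrow> (\<lambda>(a, x). smul a x) (r, 0)) (at (r, 0))"
    using continuous_smul unfolding continuous_on_def by blast
  then have lim: "((\<lambda>(a, x). smul a x) \<longlongrightarrow> smul r 0) (nhds r \<times>\<^sub>F nhds 0)"
    unfolding tendsto_at_iff_tendsto_nhds nhds_prod by simp
  have "\<forall>\<^sub>F x in nhds (smul r 0). x \<in> W"
    using assms by (simp add: smul_zero_right zero_nbhd_iff_eventually)
  from eventually_compose_filterlim[OF this lim]
  have "\<forall>\<^sub>F p in nhds r \<times>\<^sub>F nhds 0. (case p of (a, x) \<Rightarrow> smul a x) \<in> W" .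
  then obtain P Q where PQ: "eventually P (nhds r)" "eventually Q (nhds 0)"
    "\<And>a x. P a \<Longrightarrow> Q x \<Longrightarrow> smul a x \<in> W"
    by (auto simp: eventually_prod_filter)
  show thesis
  proof (rule that[of "{x. Q x}"])
    show "zero_nbhd {x. Q x}"
      using PQ(2) by (simp add: zero_nbhd_iff_eventually)
    show "\<forall>\<^sub>F a in nhds r. \<forall>x\<in>{x. Q x}. smul a x \<in> W"
      using PQ(1) by eventually_elim (auto intro: PQ(3))
  qed
qed

section \<open>Bounded sets and bounded bigroup homomorphisms\<close>

lemma module_bounded_iff_eventually:
  "module_bounded smul B \<longleftrightarrow>
    (\<forall>W. zero_nbhd W \<longrightarrow> (\<forall>\<^sub>F a in nhds 0. \<forall>b\<in>B. smul a b \<in> W))"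
proof -
  have "(\<exists>V. zero_nbhd V \<and> (\<lambda>(v, b). smul v b) ` (V \<times> B) \<subseteq> W) \<longleftrightarrow>
      (\<forall>\<^sub>F a in nhds 0. \<forall>b\<in>B. smul a b \<in> W)" (is "?L \<longleftrightarrow> ?R") for W
  proof
    assume ?L
    then obtain V where V: "\<forall>\<^sub>F a in nhds 0. a \<in> V" "(\<lambda>(v, b). smul v b) ` (V \<times> B) \<subseteq> W"
      by (auto simp: zero_nbhd_iff_eventually)
    from V(1) show ?R
      by eventually_elim (use V(2) in auto)
  next
    assume ?R
    then show ?L
      by (intro exI[of _ "{a. \<forall>b\<in>B. smul a b \<in> W}"]) (auto simp: zero_nbhd_iff_eventually)
  qed
  then show ?thesis
    by (simp add: module_bounded_def)
qed

lemma module_bounded_subset: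
  assumes "module_bounded smul B" "A \<subseteq> B"
  shows "module_bounded smul A"
  unfolding module_bounded_iff_eventually
proof (intro allI impI)
  fix W :: "'x set" assume "zero_nbhd W"
  then have "\<forall>\<^sub>F a in nhds 0. \<forall>b\<in>B. smul a b \<in> W"
    using assms(1) by (simp add: module_bounded_iff_eventually)
  then show "\<forall>\<^sub>F a in nhds 0. \<forall>b\<in>A. smul a b \<in> W"
    by eventually_elim (use assms(2) in blast)
qed

lemma module_bounded_sums:
  assumes A: "module_bounded smul A" and B: "module_bounded smul B"
  shows "module_bounded smul ((\<lambda>(a, b). a + b) ` (A \<times> B))"
  unfolding module_bounded_iff_eventually
proof (intro allI impI)
  fix W :: "'x set" assume "zero_nbhd W"
  then obtain V where V: "zero_nbhd V" "\<And>x y. x \<in> V \<Longrightarrow> y \<in> V \<Longrightarrow> x + y \<in> W"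
    using zero_nbhd_add by blast
  have "\<forall>\<^sub>F a in nhds 0. \<forall>b\<in>A. smul a b \<in> V" "\<forall>\<^sub>F a in nhds 0. \<forall>b\<in>B. smul a b \<in> V"
    using A B V(1) by (auto simp: module_bounded_iff_eventually)
  then show "\<forall>\<^sub>F a in nhds 0. \<forall>b\<in>(\<lambda>(a, b). a + b) ` (A \<times> B). smul a b \<in> W"
    by eventually_elim (auto simp: smul_add_right V(2))
qed

text \<open>Scalars need not commute, so \<open>a (r b)\<close> may differ from \<open>r (a b)\<close>. But it equals \<open>(a r) b\<close>, and \<open>a r\<close>
  tends to zero with \<open>a\<close>.\<close>

lemma module_bounded_smul_image:
  assumes B: "module_bounded smul B"
  shows "module_bounded smul (smul r ` B)"
  unfolding module_bounded_iff_eventually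
proof (intro allI impI)
  fix W :: "'x set" assume "zero_nbhd W"
  then have "\<forall>\<^sub>F a in nhds 0. \<forall>b\<in>B. smul a b \<in> W"
    using B by (simp add: module_bounded_iff_eventually)
  moreover have "((\<lambda>a. a * r) \<longlongrightarrow> 0 * r) (nhds 0)"
    by (intro tendsto_mult filterlim_ident tendsto_const)
  then have "((\<lambda>a. a * r) \<longlongrightarrow> 0) (nhds 0)"
    by simp
  ultimately have "\<forall>\<^sub>F a in nhds 0. \<forall>b\<in>B. smul (a * r) b \<in> W"
    by (rule eventually_compose_filterlim)
  then show "\<forall>\<^sub>F a in nhds 0. \<forall>b\<in>smul r ` B. smul a b \<in> W"
    by (simp add: smul_smul)
qed

lemma Bb_add:
  assumes \<sigma>: "\<sigma> \<in> Bb smul" and \<gamma>: "\<gamma> \<in> Bb smul"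
  shows "(\<lambda>p. \<sigma> p + \<gamma> p) \<in> Bb smul"
proof -
  have "bigroup_hom (\<lambda>p. \<sigma> p + \<gamma> p)"
    using \<sigma> \<gamma> by (auto simp: Bb_def bigroup_hom_def intro: additive_plus)
  moreover have "b_bounded smul (\<lambda>p. \<sigma> p + \<gamma> p)"
    unfolding b_bounded_def
  proof (intro allI impI)
    fix B1 B2 assume "module_bounded smul B1" "module_bounded smul B2"
    then have "module_bounded smul (\<sigma> ` (B1 \<times> B2))" "module_bounded smul (\<gamma> ` (B1 \<times> B2))"
      using \<sigma> \<gamma> by (auto simp: Bb_def b_bounded_def)
    from module_bounded_sums[OF this]
    show "module_bounded smul ((\<lambda>p. \<sigma> p + \<gamma> p) ` (B1 \<times> B2))"
      by (rule module_bounded_subset) auto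
  qed
  ultimately show ?thesis
    by (simp add: Bb_def)
qed

lemma Bb_smul:
  assumes \<sigma>: "\<sigma> \<in> Bb smul"
  shows "(\<lambda>p. smul r (\<sigma> p)) \<in> Bb smul"
proof -
  have "bigroup_hom (\<lambda>p. smul r (\<sigma> p))"
    using \<sigma> by (simp add: Bb_def bigroup_hom_def Modules.additive_def smul_add_right)
  moreover have "b_bounded smul (\<lambda>p. smul r (\<sigma> p))"
    unfolding b_bounded_def image_image[of "smul r" \<sigma>, symmetric]
    using \<sigma> module_bounded_smul_image by (auto simp: Bb_def b_bounded_def)
  ultimately show ?thesis
    by (simp add: Bb_def)
qed

end

section \<open>Limits of sums and multiples\<close>

text \<open>Stated for arbitrary filters rather than nets, so that the filter of punctured
  neighborhoods of a point is covered as well; this is how the limit laws below yield continuity.\<close>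

lemma limitin_ub_topology_iff:
  "limitin (ub_topology smul) s \<sigma> F \<longleftrightarrow> \<sigma> \<in> Bb smul \<and>
    (\<forall>B1 B2 W. module_bounded smul B1 \<longrightarrow> module_bounded smul B2 \<longrightarrow> zero_nbhd W \<longrightarrow>
      (\<forall>\<^sub>F \<alpha> in F. s \<alpha> \<in> ub_nbhd smul \<sigma> B1 B2 W))"
  (is "?L \<longleftrightarrow> ?R")
proof
  assume L: ?L
  then have \<sigma>: "\<sigma> \<in> Bb smul"
    by (simp add: limitin_def topspace_ub_topology)
  moreover have "\<forall>\<^sub>F \<alpha> in F. s \<alpha> \<in> ub_nbhd smul \<sigma> B1 B2 W"
    if B: "module_bounded smul B1" "module_bounded smul B2" "zero_nbhd W" for B1 B2 W
  proof -
    obtain S where S: "openin (ub_topology smul) S" "\<sigma> \<in> S" "S \<subseteq> ub_nbhd smul \<sigma> B1 B2 W"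
      using ub_nbhd_contains_openin[OF \<sigma> B] by blast
    then have "\<forall>\<^sub>F \<alpha> in F. s \<alpha> \<in> S"
      using L by (simp add: limitin_def)
    then show ?thesis
      by eventually_elim (use S(3) in blast)
  qed
  ultimately show ?R
    by blast
next
  assume R: ?R
  show ?L
    unfolding limitin_def topspace_ub_topology
  proof (intro conjI allI impI)
    show "\<sigma> \<in> Bb smul"
      using R by blast
    fix S assume "openin (ub_topology smul) S \<and> \<sigma> \<in> S"
    then obtain B1 B2 W where B: "module_bounded smul B1" "module_bounded smul B2"
      "zero_nbhd W" "ub_nbhd smul \<sigma> B1 B2 W \<subseteq> S"
      unfolding openin_ub_topology by metis
    then have "\<forall>\<^sub>F \<alpha> in F. s \<alpha> \<in> ub_nbhd smul \<sigma> B1 B2 W"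
      using R by blast
    then show "\<forall>\<^sub>F \<alpha> in F. s \<alpha> \<in> S"
      by eventually_elim (use B(4) in blast)
  qed
qed

context topological_module
begin

lemma limitin_ub_add:
  assumes s: "limitin (ub_topology smul) s \<sigma> F" and g: "limitin (ub_topology smul) g \<gamma> F"
  shows "limitin (ub_topology smul) (\<lambda>\<alpha> p. s \<alpha> p + g \<alpha> p) (\<lambda>p. \<sigma> p + \<gamma> p) F"
  unfolding limitin_ub_topology_iff
proof (intro conjI allI impI)
  show "(\<lambda>p. \<sigma> p + \<gamma> p) \<in> Bb smul"
    using s g by (auto simp: limitin_ub_topology_iff intro: Bb_add)
  fix B1 B2 W :: "'x set"
  assume B: "module_bounded smul B1" "module_bounded smul B2" and "zero_nbhd W"
  then obtain V where V: "zero_nbhd V" "\<And>x y. x \<in> V \<Longrightarrow> y \<in> V \<Longrightarrow> x + y \<in> W"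
    using zero_nbhd_add by blast
  have "\<forall>\<^sub>F \<alpha> in F. s \<alpha> \<in> ub_nbhd smul \<sigma> B1 B2 V" "\<forall>\<^sub>F \<alpha> in F. g \<alpha> \<in> ub_nbhd smul \<gamma> B1 B2 V"
    using s g B V(1) by (auto simp: limitin_ub_topology_iff)
  then show "\<forall>\<^sub>F \<alpha> in F. (\<lambda>p. s \<alpha> p + g \<alpha> p) \<in> ub_nbhd smul (\<lambda>p. \<sigma> p + \<gamma> p) B1 B2 W"
  proof eventually_elim
    case (elim \<alpha>)
    have "s \<alpha> p + g \<alpha> p - (\<sigma> p + \<gamma> p) \<in> W" if "p \<in> B1 \<times> B2" for p
    proof -
      have "s \<alpha> p - \<sigma> p \<in> V" "g \<alpha> p - \<gamma> p \<in> V"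
        using elim that by (auto simp: ub_nbhd_def)
      from V(2)[OF this] show ?thesis
        by (simp add: algebra_simps)
    qed
    then show ?case
      using elim by (auto simp: ub_nbhd_def intro: Bb_add)
  qed
qed

lemma limitin_ub_smul:
  assumes r: "(rr \<longlongrightarrow> r) F" and s: "limitin (ub_topology smul) s \<sigma> F"
  shows "limitin (ub_topology smul) (\<lambda>\<alpha> p. smul (rr \<alpha>) (s \<alpha> p)) (\<lambda>p. smul r (\<sigma> p)) F"
  unfolding limitin_ub_topology_iff
proof (intro conjI allI impI)
  have \<sigma>: "\<sigma> \<in> Bb smul"
    using s by (simp add: limitin_ub_topology_iff)
  then show "(\<lambda>p. smul r (\<sigma> p)) \<in> Bb smul"
    by (rule Bb_smul)
  fix B1 B2 W :: "'x set"
  assume B: "module_bounded smul B1" "module_bounded smul B2" and "zero_nbhd W"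
  then obtain V where V: "zero_nbhd V" "\<And>x y. x \<in> V \<Longrightarrow> y \<in> V \<Longrightarrow> x + y \<in> W"
    using zero_nbhd_add by blast
  obtain U where U: "zero_nbhd U" "\<forall>\<^sub>F a in nhds r. \<forall>x\<in>U. smul a x \<in> V"
    using smul_small_near[OF V(1)] by blast
  have "\<forall>\<^sub>F \<alpha> in F. s \<alpha> \<in> ub_nbhd smul \<sigma> B1 B2 U"
    using s B U(1) by (auto simp: limitin_ub_topology_iff)
  moreover have "\<forall>\<^sub>F \<alpha> in F. \<forall>x\<in>U. smul (rr \<alpha>) x \<in> V"
    using U(2) r by (rule eventually_compose_filterlim)
  moreover have "\<forall>\<^sub>F \<alpha> in F. \<forall>x\<in>\<sigma> ` (B1 \<times> B2). smul (rr \<alpha> - r) x \<in> V"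
  proof -
    have "module_bounded smul (\<sigma> ` (B1 \<times> B2))"
      using \<sigma> B by (simp add: Bb_def b_bounded_def)
    then have "\<forall>\<^sub>F a in nhds 0. \<forall>x\<in>\<sigma> ` (B1 \<times> B2). smul a x \<in> V"
      using V(1) unfolding module_bounded_iff_eventually by blast
    moreover have "((\<lambda>\<alpha>. rr \<alpha> - r) \<longlongrightarrow> 0) F"
      using tendsto_diff[OF r tendsto_const, of r] by simp
    ultimately show ?thesis
      by (rule eventually_compose_filterlim)
  qed
  ultimately show
    "\<forall>\<^sub>F \<alpha> in F. (\<lambda>p. smul (rr \<alpha>) (s \<alpha> p)) \<in> ub_nbhd smul (\<lambda>p. smul r (\<sigma> p)) B1 B2 W"
  proof eventually_elim
    case (elim \<alpha>)
    have "smul (rr \<alpha>) (s \<alpha> p) - smul r (\<sigma> p) \<in> W" if "p \<in> B1 \<times> B2" for p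
    proof -
      have "s \<alpha> p - \<sigma> p \<in> U"
        using elim(1) that by (auto simp: ub_nbhd_def)
      then have "smul (rr \<alpha>) (s \<alpha> p - \<sigma> p) \<in> V"
        using elim(2) by blast
      moreover have "smul (rr \<alpha> - r) (\<sigma> p) \<in> V"
        using elim(3) that by blast
      ultimately have "smul (rr \<alpha>) (s \<alpha> p - \<sigma> p) + smul (rr \<alpha> - r) (\<sigma> p) \<in> W"
        by (rule V(2))
      then show ?thesis
        by (simp add: smul_diff_left smul_diff_right)
    qed
    then show ?case
      using elim(1) by (auto simp: ub_nbhd_def intro: Bb_smul)
  qed
qed

section \<open>Continuity of the module operations\<close>

lemma continuous_map_ub_add:
  "continuous_map (prod_topology (ub_topology smul) (ub_topology smul)) (ub_topology smul)
    (\<lambda>(\<sigma>, \<gamma>). \<lambda>p. \<sigma> p + \<gamma> p)"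
  unfolding continuous_map_atin
proof
  let ?X = "prod_topology (ub_topology smul) (ub_topology smul)"
  fix x assume x: "x \<in> topspace ?X"
  have "limitin (ub_topology smul) fst (fst x) (atin ?X x)"
    "limitin (ub_topology smul) snd (snd x) (atin ?X x)"
    using continuous_map_fst[of "ub_topology smul" "ub_topology smul"] continuous_map_snd[of "ub_topology smul" "ub_topology smul"] x
    unfolding continuous_map_atin by blast+
  from limitin_ub_add[OF this]
  show "limitin (ub_topology smul) (\<lambda>(\<sigma>, \<gamma>). \<lambda>p. \<sigma> p + \<gamma> p)
      ((\<lambda>(\<sigma>, \<gamma>). \<lambda>p. \<sigma> p + \<gamma> p) x) (atin ?X x)"
    by (simp add: case_prod_unfold)
qed

lemma continuous_map_ub_smul:
  "continuous_map (prod_topology (euclidean :: 'r topology) (ub_topology smul)) (ub_topology smul)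
    (\<lambda>(r, \<sigma>). \<lambda>p. smul r (\<sigma> p))"
  unfolding continuous_map_atin
proof
  let ?X = "prod_topology (euclidean :: 'r topology) (ub_topology smul)"
  fix x assume x: "x \<in> topspace ?X"
  have "limitin euclidean fst (fst x) (atin ?X x)"
    "limitin (ub_topology smul) snd (snd x) (atin ?X x)"
    using continuous_map_fst[of "euclidean :: 'r topology" "ub_topology smul"] continuous_map_snd[of "euclidean :: 'r topology" "ub_topology smul"] x
    unfolding continuous_map_atin by blast+
  then show "limitin (ub_topology smul) (\<lambda>(r, \<sigma>). \<lambda>p. smul r (\<sigma> p))
      ((\<lambda>(r, \<sigma>). \<lambda>p. smul r (\<sigma> p)) x) (atin ?X x)"
    using limitin_ub_smul by (auto simp: case_prod_unfold)
qed

end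

theorem theorem8:
  fixes smul :: "'r::topological_ring \<Rightarrow> 'x::topological_ab_group_add \<Rightarrow> 'x"
  assumes "topological_module smul"
  shows "continuous_map (prod_topology (ub_topology smul) (ub_topology smul)) (ub_topology smul)
           (\<lambda>(\<sigma>, \<gamma>). \<lambda>p. \<sigma> p + \<gamma> p) \<and>
         continuous_map (prod_topology (euclidean :: 'r topology) (ub_topology smul)) (ub_topology smul)
           (\<lambda>(r, \<sigma>). \<lambda>p. smul r (\<sigma> p)) \<and>
         (\<forall>(D :: 'i set) le s g rr \<sigma> \<gamma> r.
           directed_set D le \<longrightarrow>
           (\<forall>\<alpha>\<in>D. s \<alpha> \<in> Bb smul) \<longrightarrow> (\<forall>\<alpha>\<in>D. g \<alpha> \<in> Bb smul) \<longrightarrow>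
           \<sigma> \<in> Bb smul \<longrightarrow> \<gamma> \<in> Bb smul \<longrightarrow>
           converges_ub smul D le s \<sigma> \<longrightarrow> converges_ub smul D le g \<gamma> \<longrightarrow>
           (rr \<longlongrightarrow> r) (net_filter D le) \<longrightarrow>
           converges_ub smul D le (\<lambda>\<alpha> p. s \<alpha> p + g \<alpha> p) (\<lambda>p. \<sigma> p + \<gamma> p) \<and>
           converges_ub smul D le (\<lambda>\<alpha> p. smul (rr \<alpha>) (s \<alpha> p)) (\<lambda>p. smul r (\<sigma> p)))"
proof -
  interpret topological_module smul by (rule assms)
  have "converges_ub smul D le (\<lambda>\<alpha> p. s \<alpha> p + g \<alpha> p) (\<lambda>p. \<sigma> p + \<gamma> p) \<and>
      converges_ub smul D le (\<lambda>\<alpha> p. smul (rr \<alpha>) (s \<alpha> p)) (\<lambda>p. smul r (\<sigma> p))"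
    if D: "directed_set D le"
      and s: "\<forall>\<alpha>\<in>D. s \<alpha> \<in> Bb smul" and g: "\<forall>\<alpha>\<in>D. g \<alpha> \<in> Bb smul"
      and \<sigma>: "\<sigma> \<in> Bb smul" and \<gamma>: "\<gamma> \<in> Bb smul"
      and conv: "converges_ub smul D le s \<sigma>" "converges_ub smul D le g \<gamma>"
      and r: "(rr \<longlongrightarrow> r) (net_filter D le)"
    for D :: "'i set" and le s g rr \<sigma> \<gamma> r
  proof -
    have "limitin (ub_topology smul) s \<sigma> (net_filter D le)"
      "limitin (ub_topology smul) g \<gamma> (net_filter D le)"
      using D s g \<sigma> \<gamma> conv by (simp_all add: limitin_ub_topology)
    then have
      "limitin (ub_topology smul) (\<lambda>\<alpha> p. s \<alpha> p + g \<alpha> p) (\<lambda>p. \<sigma> p + \<gamma> p) (net_filter D le)"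
      "limitin (ub_topology smul) (\<lambda>\<alpha> p. smul (rr \<alpha>) (s \<alpha> p)) (\<lambda>p. smul r (\<sigma> p))
        (net_filter D le)"
      using r by (auto intro: limitin_ub_add limitin_ub_smul)
    then show ?thesis
      using limitin_ub_topology[OF D, where smul = smul] s g \<sigma> \<gamma> by (simp add: Bb_add Bb_smul)
  qed
  then show ?thesis
    using continuous_map_ub_add continuous_map_ub_smul by blast
qed

end
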